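(* Let $V$ be a valuation domain with maximal ideal $M$, quotient field $K$ and valuation $v$. Let $E=\{s_n\}_{n\in\mathbb{N}}\subset K$ be a pseudo-convergent sequence and suppose that $\beta\in K$ is a pseudo-limit of $E$; let $\alpha\in K$. Let $V_E$ be the valuation domain of $K(X)$ associated to $E$, with valuation $v_E$, maximal ideal $M_E$ and value group $\Gamma_{v_E}$. Then the following hold. (a) $v_E(X-\alpha)\leq v_E(X-\beta)$, and equality holds if and only if $\alpha$ is a pseudo-limit of $E$. Let $\Delta_E=v_E(X-\beta)\in\Gamma_{v_E}$ (which by (a) does not depend on the choice of the pseudo-limit $\beta\in K$ of $E$). (b) $\Delta_E$ is not a torsion element in $\Gamma_{v_E}/\Gamma_v$ (i.e., if $k\in\mathbb{N}$ is such that $k\Delta_E\in\Gamma_v$, then $k=0$). In particular, $v_E=v_{\beta,\Delta_E}$. (c) $\Gamma_{v_E}=\mathbb{Z}\Delta_E\oplus\Gamma_v$ (as groups). (d) $V_E/M_E\cong V/M$.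
   Context: $V$ is a valuation domain of arbitrary rank with value group $\Gamma_v$. A sequence $E=\{s_n\}_{n\in\mathbb{N}}$ in $K$ is pseudo-convergent if $v(s_{n+1}-s_n)<v(s_{n+2}-s_{n+1})$ for all $n\in\mathbb{N}$; an element $\alpha\in K$ is a pseudo-limit of $E$ if $v(\alpha-s_n)<v(\alpha-s_{n+1})$ for all $n$. $V_E=\{\phi\in K(X)\mid \phi(s_n)\in V\text{ for all but finitely many }n\in\mathbb{N}\}$, which is a valuation domain of $K(X)$ with $V_E\cap K=V$; $v_E$ denotes its valuation, normalized so that it extends $v$, and $\Gamma_v$ is regarded as a subgroup of $\Gamma_{v_E}$. Given a totally ordered group $\Gamma\supseteq\Gamma_v$, $\alpha\in K$ and $\delta\in\Gamma$, the monomial valuation $v_{\alpha,\delta}$ is the valuation of $K(X)$ defined on polynomials $f(X)=a_0+a_1(X-\alpha)+\cdots+a_n(X-\alpha)^n\in K[X]$ by $v_{\alpha,\delta}(f)=\inf\{v(a_i)+i\delta\mid i=0,\ldots,n\}$. *)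

theory Defs
  imports "HOL-Computational_Algebra.Polynomial" "HOL-Computational_Algebra.Fraction_Field"
    "HOL-Computational_Algebra.Group_Closure" "HOL-Algebra.QuotRing"
begin

text \<open>
  The field \<open>K\<close> is a type of class \<^class>\<open>field\<close>, its rational function field \<open>K(X)\<close> is the type of
  fractions of polynomials over it. A valuation takes values in a totally ordered abelian group.
  It is relevant only on nonzero arguments: the value at \<open>0\<close> is to be read as infinity, so
  conditions that involve it are spelled out separately and never mention \<open>v 0\<close>.
\<close>

definition is_valuation :: "('k::field \<Rightarrow> 'g::linordered_ab_group_add) \<Rightarrow> bool" where
  "is_valuation v \<longleftrightarrow>
     (\<forall>x y. x \<noteq> 0 \<longrightarrow> y \<noteq> 0 \<longrightarrow> v (x * y) = v x + v y) \<and>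
     (\<forall>x y. x \<noteq> 0 \<longrightarrow> y \<noteq> 0 \<longrightarrow> x + y \<noteq> 0 \<longrightarrow> min (v x) (v y) \<le> v (x + y))"

text \<open>\<open>V\<close> is a valuation domain of the field \<open>'k\<close> (its quotient field), with valuation \<open>v\<close>.\<close>

definition valuation_domain_with :: "'k::field set \<Rightarrow> ('k \<Rightarrow> 'g::linordered_ab_group_add) \<Rightarrow> bool" where
  "valuation_domain_with V v \<longleftrightarrow> is_valuation v \<and> V = {x. x = 0 \<or> 0 \<le> v x}"

definition value_group :: "('k::field \<Rightarrow> 'g::linordered_ab_group_add) \<Rightarrow> 'g set" where
  "value_group v = v ` (- {0})"

definition val_less :: "('k::field \<Rightarrow> 'g::linordered_ab_group_add) \<Rightarrow> 'k \<Rightarrow> 'k \<Rightarrow> bool" where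
  \<comment> \<open>\<open>v x < v y\<close> with \<open>v 0 = \<infinity>\<close>\<close>
  "val_less v x y \<longleftrightarrow> x \<noteq> 0 \<and> (y = 0 \<or> v x < v y)"

definition pseudo_convergent ::
    "('k::field \<Rightarrow> 'g::linordered_ab_group_add) \<Rightarrow> (nat \<Rightarrow> 'k) \<Rightarrow> bool" where
  "pseudo_convergent v s \<longleftrightarrow>
     (\<forall>n. val_less v (s (n + 1) - s n) (s (n + 2) - s (n + 1)))"

definition pseudo_limit ::
    "('k::field \<Rightarrow> 'g::linordered_ab_group_add) \<Rightarrow> (nat \<Rightarrow> 'k) \<Rightarrow> 'k \<Rightarrow> bool" where
  "pseudo_limit v s \<alpha> \<longleftrightarrow> (\<forall>n. val_less v (\<alpha> - s n) (\<alpha> - s (n + 1)))"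

definition of_poly :: "'k::field poly \<Rightarrow> 'k poly fract" where
  "of_poly f = Fract f 1"

definition has_value_at :: "'k::field poly fract \<Rightarrow> 'k \<Rightarrow> 'k \<Rightarrow> bool" where
  \<comment> \<open>the rational function \<open>\<phi>\<close> has no pole at \<open>a\<close>, and \<open>\<phi>(a) = y\<close>\<close>
  "has_value_at \<phi> a y \<longleftrightarrow> (\<exists>f g. \<phi> = Fract f g \<and> poly g a \<noteq> 0 \<and> y = poly f a / poly g a)"

definition V_seq :: "'k::field set \<Rightarrow> (nat \<Rightarrow> 'k) \<Rightarrow> 'k poly fract set" where
  \<comment> \<open>the ring \<open>V\<^sub>E\<close> of the sequence \<open>E = (s n)\<close>; the value at \<open>s n\<close> may be undefined for finitely many \<open>n\<close>\<close>
  "V_seq V s = {\<phi>. finite {n. \<not> (\<exists>y\<in>V. has_value_at \<phi> (s n) y)}}"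

definition extends_valuation ::
    "('k::field poly fract \<Rightarrow> 'g::linordered_ab_group_add) \<Rightarrow> ('k \<Rightarrow> 'g) \<Rightarrow> bool" where
  "extends_valuation w v \<longleftrightarrow> (\<forall>a. a \<noteq> 0 \<longrightarrow> w (of_poly [:a:]) = v a)"

definition nmult :: "nat \<Rightarrow> 'g::ab_group_add \<Rightarrow> 'g" where
  "nmult k x = (\<Sum>_<k. x)"

definition monomial_val_poly ::
    "('k::field \<Rightarrow> 'g::linordered_ab_group_add) \<Rightarrow> 'k \<Rightarrow> 'g \<Rightarrow> 'k poly \<Rightarrow> 'g" where
  \<comment> \<open>The \<open>X - \<alpha>\<close>-adic coefficients of \<open>f\<close> are the coefficients of \<open>f(X + \<alpha>)\<close>, see
      \<open>taylor_expansion\<close> below; the zero ones have value infinity and do not affect the infimum.\<close>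
  "monomial_val_poly v \<alpha> \<delta> f =
     (let a = coeff (pcompose f [:\<alpha>, 1:])
      in Min {v (a i) + nmult i \<delta> | i. i \<le> degree f \<and> a i \<noteq> 0})"

definition monomial_val ::
    "('k::field \<Rightarrow> 'g::linordered_ab_group_add) \<Rightarrow> 'k \<Rightarrow> 'g \<Rightarrow> 'k poly fract \<Rightarrow> 'g" where
  "monomial_val v \<alpha> \<delta> \<phi> =
     (THE \<gamma>. \<exists>f g. f \<noteq> 0 \<and> g \<noteq> 0 \<and> \<phi> = Fract f g \<and>
        \<gamma> = monomial_val_poly v \<alpha> \<delta> f - monomial_val_poly v \<alpha> \<delta> g)"

definition internal_direct_sum :: "'g::ab_group_add set \<Rightarrow> 'g set \<Rightarrow> 'g set \<Rightarrow> bool" where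
  "internal_direct_sum G A B \<longleftrightarrow> G = {a + b | a b. a \<in> A \<and> b \<in> B} \<and> A \<inter> B = {0}"

definition ring_on :: "'k::comm_ring_1 set \<Rightarrow> 'k ring" where
  "ring_on A = \<lparr>carrier = A, mult = (*), one = 1, zero = 0, add = (+)\<rparr>"

lemma taylor_expansion:
  fixes f :: "'k::field poly"
  shows "f = (\<Sum>i\<le>degree f. smult (coeff (pcompose f [:\<alpha>, 1:]) i) ([:-\<alpha>, 1:] ^ i))"
proof -
  define p where "p = pcompose f [:\<alpha>, 1:]"
  have deg: "degree p \<le> degree f"
    unfolding p_def using degree_pcompose_le[of f "[:\<alpha>, 1:]"] by simp
  have pow: "pcompose ([:0, 1:] ^ i) [:-\<alpha>, 1:] = [:-\<alpha>, 1:] ^ i" for i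
    by (induction i) (simp_all add: pcompose_1 pcompose_mult pcompose_pCons)
  have "f = pcompose p [:-\<alpha>, 1:]"
    unfolding p_def by (simp add: pcompose_assoc[symmetric] pcompose_pCons)
  also have "p = (\<Sum>i\<le>degree f. smult (coeff p i) ([:0, 1:] ^ i))"
    using poly_as_sum_of_monoms'[OF deg] by (simp add: monom_altdef)
  finally show ?thesis
    unfolding p_def[symmetric] by (simp add: pcompose_sum pcompose_smult pow)
qed

end

theory Submission
  imports Defs
begin

text \<open>
  If \<open>k \<Delta>\<^sub>E = v a\<close> for some \<open>k > 0\<close>, then \<open>(X - \<beta>)\<^sup>k / a\<close> is a unit of \<open>V\<^sub>E\<close>, so
  \<open>k v(\<beta> - s n)\<close> is eventually constant, whereas \<open>v(\<beta> - s n)\<close> increases strictly. So \<open>\<Delta>\<^sub>E\<close> is not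
  torsion modulo the value group of \<open>v\<close>, and the nonzero terms of an \<open>(X - \<beta>)\<close>-adic expansion have
  distinct values. Hence every nonzero \<open>\<phi>\<close> has a leading term \<open>a (X - \<beta>)\<^sup>i / (X - \<beta>)\<^sup>j\<close>, from which
  the formula for \<open>v\<^sub>E\<close>, its value group and its residue field are read off. For (a), compare
  \<open>s n - \<alpha>\<close> with \<open>s n - \<beta>\<close>: either \<open>v(\<alpha> - \<beta>) > v(\<beta> - s n)\<close> for all \<open>n\<close> and the two values agree, or
  \<open>v(s n - \<alpha>)\<close> is eventually constant.
\<close>

section \<open>Values of sums, products and quotients, and leading terms\<close>

locale valued_field =
  fixes v :: "'k::field \<Rightarrow> 'g::linordered_ab_group_add"
  assumes is_valuation: "is_valuation v"
begin

lemma mult: "x \<noteq> 0 \<Longrightarrow> y \<noteq> 0 \<Longrightarrow> v (x * y) = v x + v y"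
  and add_ge: "x \<noteq> 0 \<Longrightarrow> y \<noteq> 0 \<Longrightarrow> x + y \<noteq> 0 \<Longrightarrow> min (v x) (v y) \<le> v (x + y)"
  using is_valuation unfolding is_valuation_def by blast+

lemma one [simp]: "v 1 = 0"
  using mult[of 1 1] by simp

lemma minus [simp]: "v (- x) = v x"
proof (cases "x = 0")
  case False
  have "v (-1) + v (-1) = 0"
    using mult[of "-1" "-1"] by simp
  \<comment> \<open>An ordered group has no 2-torsion.\<close>
  then have "v (-1) = 0" by simp
  then show ?thesis using mult[of "-1" x] False by simp
qed simp

lemma minus_commute: "v (x - y) = v (y - x)"
  using minus[of "x - y"] by simp

lemma divide: "x \<noteq> 0 \<Longrightarrow> y \<noteq> 0 \<Longrightarrow> v (x / y) = v x - v y"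
  using mult[of "x / y" y] by (simp add: eq_diff_eq)

lemma power: "x \<noteq> 0 \<Longrightarrow> v (x ^ n) = nmult n (v x)"
  by (induction n) (simp_all add: nmult_def mult add.commute)

lemma zero_in_value_group: "0 \<in> value_group v"
  unfolding value_group_def by (metis Compl_iff image_eqI one singletonD zero_neq_one)

lemma val_less_zero [simp]: "val_less v a 0 \<longleftrightarrow> a \<noteq> 0"
  by (simp add: val_less_def)

lemma val_less_add:
  assumes "val_less v a x" "val_less v a y"
  shows "val_less v a (x + y)"
proof (cases "x = 0 \<or> y = 0 \<or> x + y = 0")
  case True
  then show ?thesis using assms by (auto simp: val_less_def)
next
  case False
  then show ?thesis using assms add_ge[of x y] by (auto simp: val_less_def min_def split: if_splits)
qed

lemma val_less_minus [simp]: "val_less v a (- x) \<longleftrightarrow> val_less v a x"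
  by (simp add: val_less_def)

lemma val_less_diff: "val_less v a x \<Longrightarrow> val_less v a y \<Longrightarrow> val_less v a (x - y)"
  using val_less_add[of a x "- y"] by simp

lemma val_less_sum:
  assumes "a \<noteq> 0" "\<And>i. i \<in> I \<Longrightarrow> val_less v a (x i)"
  shows "val_less v a (sum x I)"
  using assms(2) by (induction I rule: infinite_finite_induct) (auto intro: val_less_add simp: assms(1))

text \<open>If \<open>a + x\<close> were zero, \<open>x = - a\<close> would have the value of
  \<open>a\<close>. Otherwise the ultrametric inequality for \<open>a + x\<close> gives one bound,
  and the one for \<open>a = (a + x) - x\<close> gives the other.\<close>

lemma val_less_nonzero_add:
  assumes "val_less v a x"
  shows "a + x \<noteq> 0" and "v (a + x) = v a"
proof -
  have a: "a \<noteq> 0" using assms by (simp add: val_less_def)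
  have *: "v (- x) = v x" by simp
  show nz: "a + x \<noteq> 0"
    using assms * by (auto simp: val_less_def add_eq_0_iff)
  show "v (a + x) = v a"
  proof (cases "x = 0")
    case False
    then have "v a < v x" using assms by (simp add: val_less_def)
    moreover have "v a \<le> v (a + x)"
      using add_ge[of a x] False a nz \<open>v a < v x\<close> by simp
    moreover have "min (v (a + x)) (v x) \<le> v a"
      using add_ge[of "a + x" "- x"] False a nz by simp
    ultimately show ?thesis by (auto simp: min_def split: if_splits)
  qed simp
qed

text \<open>\<open>val_less v y (x - y)\<close> says that \<open>x\<close> and \<open>y\<close> have the same leading term.\<close>

lemma leading_term:
  assumes "val_less v y (x - y)"
  shows "x \<noteq> 0" and "v x = v y"
  using val_less_nonzero_add[OF assms] by simp_all

lemma val_less_mult_left: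
  assumes "c \<noteq> 0"
  shows "val_less v (c * a) (c * x) \<longleftrightarrow> val_less v a x"
  using assms by (cases "x = 0") (auto simp: val_less_def mult)

text \<open>Over the denominator \<open>x' * y'\<close> the error has numerator
  \<open>y' * (x - y) - y * (x' - y')\<close>. Its value exceeds \<open>v (y * y')\<close>, while
  the denominator has value \<open>2 v y'\<close>, so the quotient lies above
  \<open>v y - v y'\<close>.\<close>

lemma leading_term_divide:
  assumes "val_less v y (x - y)" "val_less v y' (x' - y')"
  shows "val_less v (y / y') (x / x' - y / y')"
proof -
  have nz: "y \<noteq> 0" "y' \<noteq> 0" "x' \<noteq> 0"
    using assms leading_term(1)[OF assms(2)] by (auto simp: val_less_def)
  have vx': "v x' = v y'" using leading_term(2)[OF assms(2)] .
  have "val_less v (y' * y) (y' * (x - y))" "val_less v (y * y') (y * (x' - y'))"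
    using assms nz by (simp_all add: val_less_mult_left)
  then have "val_less v (y * y') (y' * (x - y) - y * (x' - y'))"
    by (intro val_less_diff) (simp_all add: mult.commute)
  moreover have "x / x' - y / y' = (y' * (x - y) - y * (x' - y')) / (x' * y')"
    using nz by (simp add: field_simps)
  ultimately show ?thesis
    using nz by (cases "y' * (x - y) = y * (x' - y')") (auto simp: val_less_def divide mult vx' algebra_simps)
qed

text \<open>When the values are distinct, the minimum is attained by one term only. All others lie
  strictly above it, and so does their sum.\<close>

lemma leading_term_sum:
  assumes "finite I" "I \<noteq> {}" "\<And>i. i \<in> I \<Longrightarrow> x i \<noteq> 0" "inj_on (\<lambda>i. v (x i)) I"
  obtains i where "i \<in> I" "v (x i) = Min ((\<lambda>i. v (x i)) ` I)" "val_less v (x i) (sum x I - x i)"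
proof -
  have "Min ((\<lambda>i. v (x i)) ` I) \<in> (\<lambda>i. v (x i)) ` I"
    using assms by (intro Min_in) auto
  then obtain i where i: "i \<in> I" "v (x i) = Min ((\<lambda>i. v (x i)) ` I)" by auto
  have "val_less v (x i) (x j)" if "j \<in> I - {i}" for j
  proof -
    have "v (x i) \<le> v (x j)" using i that assms(1) by simp
    moreover have "v (x i) \<noteq> v (x j)" using inj_onD[OF assms(4), of i j] i that by blast
    ultimately have "v (x i) < v (x j)" by (rule order.not_eq_order_implies_strict[rotated])
    then show ?thesis using assms(3) i by (simp add: val_less_def)
  qed
  then have "val_less v (x i) (sum x (I - {i}))"
    using assms(3) i by (intro val_less_sum) auto
  then show ?thesis
    using i assms(1) that by (simp add: sum_diff1)
qed

end

section \<open>The valuation ring, its maximal ideal and its residue field\<close>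

lemma ring_on_simps [simp]:
  "carrier (ring_on A) = A" "mult (ring_on A) = (*)" "one (ring_on A) = 1"
  "zero (ring_on A) = 0" "add (ring_on A) = (+)"
  by (simp_all add: ring_on_def)

lemma cring_ring_on:
  assumes "1 \<in> A" "\<And>x y. x \<in> A \<Longrightarrow> y \<in> A \<Longrightarrow> x - y \<in> A" "\<And>x y. x \<in> A \<Longrightarrow> y \<in> A \<Longrightarrow> x * y \<in> A"
  shows "cring (ring_on A)"
proof -
  have 0: "0 \<in> A" using assms(2)[of 1 1] assms(1) by simp
  have neg: "- x \<in> A" if "x \<in> A" for x using assms(2)[OF 0 that] by simp
  have add: "x + y \<in> A" if "x \<in> A" "y \<in> A" for x y using assms(2)[OF that(1) neg[OF that(2)]] by simp
  show ?thesis
    by (rule cringI[OF abelian_groupI comm_monoidI])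
      (auto simp: assms 0 add algebra_simps intro!: bexI[OF _ neg])
qed

locale valuation_domain = valued_field v for v :: "'k::field \<Rightarrow> 'g::linordered_ab_group_add" +
  fixes V :: "'k set"
  assumes V_eq: "V = {x. x = 0 \<or> 0 \<le> v x}"
begin

lemma cring: "cring (ring_on V)"
proof (rule cring_ring_on)
  show "x - y \<in> V" if "x \<in> V" "y \<in> V" for x y
    using that add_ge[of x "- y"]
    by (cases "x = 0"; cases "y = 0"; cases "x - y = 0") (auto simp: V_eq min_def split: if_splits)
  show "x * y \<in> V" if "x \<in> V" "y \<in> V" for x y
    using that by (cases "x = 0"; cases "y = 0") (auto simp: V_eq mult)
qed (simp add: V_eq)

text \<open>The elements of positive value form a proper ideal, and an element of \<open>V\<close>
  outside it is a unit. So every maximal ideal is contained in that ideal, hence equal to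
  it.\<close>

lemma maximal_ideal_eq:
  assumes "maximalideal M (ring_on V)"
  shows "M = {x. x = 0 \<or> 0 < v x}"
proof -
  interpret maximalideal M "ring_on V" by fact
  let ?m = "{x. x = 0 \<or> 0 < v x}"
  have m: "ideal ?m (ring_on V)"
  proof (rule idealI)
    interpret R: cring "ring_on V" by (rule cring)
    show "ring (ring_on V)" ..
    \<comment> \<open>The negation of the ring record is defined abstractly through its additive
      group and has to be identified with that of the field.\<close>
    have neg: "\<ominus>\<^bsub>ring_on V\<^esub> x = - x" if "x \<in> ?m" for x
      using that by (intro R.sum_zero_eq_neg[symmetric]) (auto simp: V_eq)
    \<comment> \<open>Since \<open>v 1 = 0\<close>, membership in \<open>?m\<close> is
      \<open>val_less v 1\<close>.\<close>
    have "x + y \<in> ?m" if "x \<in> ?m" "y \<in> ?m" for x y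
      using that val_less_add[of 1 x y] by (simp add: val_less_def)
    then show "subgroup ?m (add_monoid (ring_on V))"
      using neg by (intro group.subgroupI[OF a_group]) (auto simp: V_eq a_inv_def)
    show "x \<otimes>\<^bsub>ring_on V\<^esub> a \<in> ?m" "a \<otimes>\<^bsub>ring_on V\<^esub> x \<in> ?m"
      if "a \<in> ?m" "x \<in> carrier (ring_on V)" for a x
      using that by (cases "a = 0"; cases "x = 0"; auto simp: V_eq mult add_nonneg_pos add_pos_nonneg)+
  qed
  have "M \<subseteq> ?m"
  proof
    fix x assume x: "x \<in> M"
    have V: "x \<in> V" using Icarr[OF x] by simp
    show "x \<in> ?m"
    proof (rule ccontr)
      assume "x \<notin> ?m"
      then have "x \<noteq> 0" "v x = 0" using V by (auto simp: V_eq)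
      then have "inverse x \<in> V" using divide[of 1 x] by (simp add: V_eq inverse_eq_divide)
      then have "1 \<in> M" using I_l_closed[OF x, of "inverse x"] \<open>x \<noteq> 0\<close> by simp
      then have "M = carrier (ring_on V)" using one_imp_carrier by simp
      with I_notcarr show False by simp
    qed
  qed
  moreover have "?m \<noteq> carrier (ring_on V)"
  proof -
    have "1 \<in> V" "1 \<notin> ?m" by (auto simp: V_eq)
    then show ?thesis by auto
  qed
  moreover have "?m \<subseteq> carrier (ring_on V)" by (auto simp: V_eq)
  ultimately show ?thesis using I_maximal[OF m] by blast
qed

end

text \<open>As \<open>h\<close> preserves values, it maps \<open>V\<close> into \<open>W\<close> and
  pulls \<open>N\<close> back to \<open>M\<close>, so the induced map from \<open>V\<close> to the
  residue field of \<open>W\<close> has kernel \<open>M\<close>. By \<open>surj\<close>, each unit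
  of \<open>W\<close> is congruent modulo \<open>N\<close> to some \<open>h x\<close>, so this map
  is onto and the isomorphism theorem applies.\<close>

lemma residue_field_iso:
  fixes h :: "'a::field \<Rightarrow> 'b::field"
  assumes V: "valuation_domain v V" and W: "valuation_domain w W"
    and M: "maximalideal M (ring_on V)" and N: "maximalideal N (ring_on W)"
    and h: "h 1 = 1" "\<And>x y. h (x + y) = h x + h y" "\<And>x y. h (x * y) = h x * h y"
    and w_h: "\<And>x. x \<noteq> 0 \<Longrightarrow> w (h x) = v x"
    and surj: "\<And>y. y \<noteq> 0 \<Longrightarrow> w y = 0 \<Longrightarrow> \<exists>x. x \<noteq> 0 \<and> val_less w (h x) (y - h x)"
  shows "ring_on W Quot N \<simeq> ring_on V Quot M"
proof -
  interpret V: valuation_domain v V by fact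
  interpret W: valuation_domain w W by fact
  interpret M: maximalideal M "ring_on V" by fact
  interpret N: maximalideal N "ring_on W" by fact
  have M_eq: "M = {x. x = 0 \<or> 0 < v x}" and N_eq: "N = {x. x = 0 \<or> 0 < w x}"
    using V.maximal_ideal_eq[OF M] W.maximal_ideal_eq[OF N] .
  have h0: "h 0 = 0" using h(2)[of 0 0] by (metis add.right_neutral add_left_cancel)
  have h_nz: "h x \<noteq> 0" if "x \<noteq> 0" for x
    using h(3)[of x "inverse x"] h(1) that by auto
  have hV: "h x \<in> W" if "x \<in> V" for x
    using that w_h[of x] h0 by (cases "x = 0") (auto simp: V.V_eq W.V_eq)
  have hM: "h x \<in> N \<longleftrightarrow> x \<in> M" for x
    using w_h[of x] h0 h_nz[of x] by (cases "x = 0") (auto simp: M_eq N_eq)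
  let ?q = "\<lambda>x. N +>\<^bsub>ring_on W\<^esub> h x"
  have "h \<in> ring_hom (ring_on V) (ring_on W)"
    using hV h by (auto intro!: ring_hom_memI)
  from ring_hom_trans[OF this N.rcos_ring_hom]
  have q: "?q \<in> ring_hom (ring_on V) (ring_on W Quot N)" by (simp add: comp_def)
  have q_eq: "N +>\<^bsub>ring_on W\<^esub> x = N +>\<^bsub>ring_on W\<^esub> y" if "x - y \<in> N" "y \<in> W" for x y
  proof -
    have "x \<in> N +>\<^bsub>ring_on W\<^esub> y"
      using that by (auto simp: a_r_coset_def' intro!: bexI[of _ "x - y"])
    with N.a_repr_independence'[of x y] that(2) show ?thesis by simp
  qed
  interpret q: ring_hom_ring "ring_on V" "ring_on W Quot N" ?q
    by (intro ring_hom_ringI2 q M.ring_axioms N.quotient_is_ring)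
  have zero: "\<zero>\<^bsub>ring_on W Quot N\<^esub> = N" by (simp add: FactRing_def)
  have "a_kernel (ring_on V) (ring_on W Quot N) ?q = M"
  proof -
    have "?q x = N \<longleftrightarrow> x \<in> M" if "x \<in> V" for x
    proof
      assume *: "?q x = N"
      have "0 \<in> N" by (simp add: N_eq)
      then have "h x \<in> ?q x" by (auto simp: a_r_coset_def' intro!: bexI[of _ 0])
      then show "x \<in> M" using * hM by simp
    next
      assume "x \<in> M"
      then have "?q x = N +>\<^bsub>ring_on W\<^esub> 0" using hM by (intro q_eq) (auto simp: W.V_eq)
      then show "?q x = N" by (simp add: a_r_coset_def')
    qed
    moreover have "M \<subseteq> V" using M.a_subset by simp
    ultimately have "{x \<in> V. ?q x = N} = M" by blast
    then show ?thesis unfolding a_kernel_def' zero by simp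
  qed
  moreover have "?q ` carrier (ring_on V) = carrier (ring_on W Quot N)"
  proof -
    have "\<exists>x\<in>V. N +>\<^bsub>ring_on W\<^esub> y = ?q x" if y: "y \<in> W" for y
    proof (cases "y \<in> N")
      case True
      have "N +>\<^bsub>ring_on W\<^esub> y = ?q 0"
        using True by (intro q_eq) (auto simp: h0 W.V_eq)
      then show ?thesis by (auto simp: V.V_eq)
    next
      case False
      then have y0: "y \<noteq> 0" "w y = 0" using y by (auto simp: N_eq W.V_eq)
      from surj[OF this] obtain x where x: "x \<noteq> 0" "val_less w (h x) (y - h x)" by blast
      \<comment> \<open>\<open>h x\<close> inherits the value 0 of \<open>y\<close>, so
        \<open>x\<close> is a unit of \<open>V\<close> and the error \<open>y - h x\<close> has
        positive value.\<close>
      have vx: "v x = 0" using W.leading_term(2)[OF x(2)] y0(2) w_h[OF x(1)] by simp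
      then have xV: "x \<in> V" by (simp add: V.V_eq)
      have "y - h x \<in> N" using x(2) vx w_h[OF x(1)] by (auto simp: val_less_def N_eq)
      then have "N +>\<^bsub>ring_on W\<^esub> y = ?q x" using hV[OF xV] by (intro q_eq)
      then show ?thesis using xV by blast
    qed
    then have "(\<lambda>y. N +>\<^bsub>ring_on W\<^esub> y) ` W \<subseteq> ?q ` V"
      by (simp add: image_subset_iff image_iff)
    moreover have "?q ` V \<subseteq> carrier (ring_on W Quot N)"
      using q.hom_closed by auto
    moreover have "carrier (ring_on W Quot N) = (\<lambda>y. N +>\<^bsub>ring_on W\<^esub> y) ` W"
      by (auto simp: FactRing_def A_RCOSETS_def')
    ultimately show ?thesis by simp
  qed
  ultimately have "ring_on V Quot M \<simeq> ring_on W Quot N"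
    using q.FactRing_iso by simp
  then show ?thesis
    using ring_iso_sym[OF M.quotient_is_ring] by blast
qed

section \<open>Polynomials as rational functions, and their expansions in
  \<open>X - \<beta>\<close>\<close>

lemma of_poly_simps [simp]:
  "of_poly 0 = 0" "of_poly 1 = 1" "of_poly (f + g) = of_poly f + of_poly g"
  "of_poly (f * g) = of_poly f * of_poly g" "of_poly f = 0 \<longleftrightarrow> f = 0"
  by (simp_all add: of_poly_def Zero_fract_def One_fract_def eq_fract)

lemma of_poly_power [simp]: "of_poly (f ^ n) = of_poly f ^ n"
  by (induction n) simp_all

lemma of_poly_sum [simp]: "of_poly (sum f I) = (\<Sum>i\<in>I. of_poly (f i))"
  by (induction I rule: infinite_finite_induct) simp_all

lemma of_poly_smult: "of_poly (smult a f) = of_poly [:a:] * of_poly f"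
  by (simp flip: of_poly_simps(4))

lemma Fract_eq_of_poly: "g \<noteq> 0 \<Longrightarrow> Fract f g = of_poly f / of_poly g"
  by (simp add: of_poly_def)

lemma nmult_simps [simp]: "nmult 0 x = 0" "nmult (Suc k) x = nmult k x + x"
  by (simp_all add: nmult_def add.commute)

lemma nmult_add: "nmult (k + l) x = nmult k x + nmult l x"
  by (induction l) (simp_all add: ac_simps)

lemma nmult_strict_mono:
  fixes x y :: "'g::linordered_ab_group_add"
  assumes "x < y" "0 < k"
  shows "nmult k x < nmult k y"
  using sum_strict_mono[of "{..<k}" "\<lambda>_. x" "\<lambda>_. y"] assms by (auto simp: nmult_def)

text \<open>\<open>nmult\<close> has natural multiples only, so an integer multiple is written as a
  difference of two of them.\<close>

lemma group_closure_singleton: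
  "group_closure {x} = {nmult i x - nmult j x | i j. True}" (is "_ = ?A")
proof
  have "y \<in> ?A" if "y \<in> group_closure {x}" for y
    using that
  proof induction
    case (base y)
    then have "y = nmult 0 x - nmult 0 x \<or> y = nmult 1 x - nmult 0 x" by (auto simp: nmult_def)
    then show ?case by blast
  next
    case (diff y z)
    then obtain i j k l where "y = nmult i x - nmult j x" "z = nmult k x - nmult l x" by blast
    then have "y - z = nmult (i + l) x - nmult (j + k) x" by (simp add: nmult_add)
    then show ?case by blast
  qed
  then show "group_closure {x} \<subseteq> ?A" by blast
  have "nmult i x \<in> group_closure {x}" for i
    by (induction i) (auto intro: group_closure_add group_closure.base)
  then show "?A \<subseteq> group_closure {x}" by (auto intro: group_closure.diff)
qed

text \<open>The formula for the valuation, its value group and its residue field follow from these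
  assumptions alone. The sequence serves only to establish them.\<close>

locale nontorsion_extension = w: valued_field w + v: valued_field v
  for w :: "'k::field poly fract \<Rightarrow> 'g::linordered_ab_group_add" and v :: "'k \<Rightarrow> 'g" +
  fixes \<beta> :: 'k and \<Delta> :: 'g and t :: "'k poly fract"
  assumes extends: "extends_valuation w v"
    and t_eq: "t = of_poly [:-\<beta>, 1:]" and \<Delta>_eq: "\<Delta> = w t"
    and nontorsion: "nmult k \<Delta> \<in> value_group v \<Longrightarrow> k = 0"
begin

lemma t_nonzero [simp]: "t \<noteq> 0"
  by (simp add: t_eq)

lemma w_const: "a \<noteq> 0 \<Longrightarrow> w (of_poly [:a:]) = v a"
  using extends by (simp add: extends_valuation_def)

lemma w_term: "a \<noteq> 0 \<Longrightarrow> w (of_poly [:a:] * t ^ i) = v a + nmult i \<Delta>"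
  by (simp add: w.mult w.power w_const \<Delta>_eq)

text \<open>Cancelling the smaller multiple of \<open>\<Delta>\<close> leaves a natural multiple
  equal to the value of \<open>b / a\<close> or \<open>a / b\<close>, and \<open>nontorsion\<close>
  makes it the zeroth one. Terms \<open>a * t ^ i\<close> of different degree therefore have
  different values.\<close>

lemma nmult_eq_imp_eq:
  assumes "a \<noteq> 0" "b \<noteq> 0" "v a + nmult i \<Delta> = v b + nmult j \<Delta>"
  shows "i = j"
proof -
  have "k = 0" if "a \<noteq> 0" "b \<noteq> 0" "v a + nmult k \<Delta> = v b" for a b k
  proof (rule nontorsion)
    have "nmult k \<Delta> = v (b / a)" using that by (simp add: v.divide eq_diff_eq add.commute)
    then show "nmult k \<Delta> \<in> value_group v" using that unfolding value_group_def by auto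
  qed
  note * = this
  show ?thesis
  proof (cases "j \<le> i")
    case True
    then obtain k where "i = j + k" using le_Suc_ex by blast
    then show ?thesis using assms *[of a b k] by (simp add: nmult_add algebra_simps)
  next
    case False
    then obtain k where "j = i + k" by (metis le_Suc_ex linear)
    then show ?thesis using assms *[of b a k] by (simp add: nmult_add algebra_simps)
  qed
qed

text \<open>The nonzero terms of the Taylor expansion at \<open>\<beta>\<close> have distinct
  values, so one of them leads. Its value is both the minimum in \<open>monomial_val_poly\<close>
  and the value of \<open>f\<close> under \<open>w\<close>.\<close>

lemma poly_leading_term:
  assumes "f \<noteq> 0"
  obtains a i where "a \<noteq> 0" "val_less w (of_poly [:a:] * t ^ i) (of_poly f - of_poly [:a:] * t ^ i)"
    "monomial_val_poly v \<beta> \<Delta> f = w (of_poly f)"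
proof -
  define c where "c = coeff (pcompose f [:\<beta>, 1:])"
  \<comment> \<open>Zero coefficients are dropped, because \<open>v 0\<close> carries no meaning.
    These are also the indices over which \<open>monomial_val_poly\<close> takes its
    minimum.\<close>
  define I where "I = {i. i \<le> degree f \<and> c i \<noteq> 0}"
  define x where "x i = of_poly [:c i:] * t ^ i" for i
  have fin: "finite I" by (simp add: I_def)
  have "of_poly f = (\<Sum>i\<le>degree f. x i)"
    by (subst taylor_expansion[of f \<beta>])
      (simp add: x_def c_def t_eq of_poly_smult)
  also have "\<dots> = sum x I"
    by (intro sum.mono_neutral_right) (auto simp: I_def x_def)
  finally have f_eq: "of_poly f = sum x I" .
  have "I \<noteq> {}"
    using f_eq assms by (metis of_poly_simps(5) sum.empty)
  moreover have "x i \<noteq> 0" if "i \<in> I" for i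
    using that by (simp add: I_def x_def)
  moreover have wx: "w (x i) = v (c i) + nmult i \<Delta>" if "i \<in> I" for i
    using that by (simp add: I_def x_def w_term)
  have "inj_on (\<lambda>i. w (x i)) I"
  proof (rule inj_onI)
    fix i j assume "i \<in> I" "j \<in> I" "w (x i) = w (x j)"
    then show "i = j" using nmult_eq_imp_eq[of "c i" "c j" i j] wx by (simp add: I_def)
  qed
  ultimately obtain i where i: "i \<in> I" "w (x i) = Min ((\<lambda>i. w (x i)) ` I)"
      "val_less w (x i) (sum x I - x i)"
    using w.leading_term_sum[OF fin, of x] by blast
  have "{v (c i) + nmult i \<Delta> | i. i \<le> degree f \<and> c i \<noteq> 0} = (\<lambda>i. w (x i)) ` I"
    using wx by (force simp: I_def)
  then have "monomial_val_poly v \<beta> \<Delta> f = w (x i)"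
    using i(2) unfolding monomial_val_poly_def c_def[symmetric] Let_def by simp
  moreover have "w (of_poly f) = w (x i)"
    using w.leading_term(2) i(3) f_eq by simp
  ultimately show ?thesis
    using that[of "c i" i] i f_eq by (simp add: x_def I_def)
qed

lemma monomial_val_poly_eq: "f \<noteq> 0 \<Longrightarrow> monomial_val_poly v \<beta> \<Delta> f = w (of_poly f)"
  by (rule poly_leading_term)

text \<open>For every representation \<open>Fract f g\<close> the difference of monomial values is
  \<open>w (Fract f g)\<close>. This settles the uniqueness that the definite description in
  \<open>monomial_val\<close> requires.\<close>

lemma monomial_val_eq:
  assumes "\<phi> \<noteq> 0"
  shows "monomial_val v \<beta> \<Delta> \<phi> = w \<phi>"
proof -
  have *: "monomial_val_poly v \<beta> \<Delta> f - monomial_val_poly v \<beta> \<Delta> g = w (Fract f g)"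
    if "f \<noteq> 0" "g \<noteq> 0" for f g
    using that by (simp add: monomial_val_poly_eq Fract_eq_of_poly w.divide)
  obtain f g where "\<phi> = Fract f g" "f \<noteq> 0" "g \<noteq> 0"
    using assms by (cases \<phi> rule: Fract_cases_nonzero) auto
  then show ?thesis
    unfolding monomial_val_def using * by (intro the_equality) (metis, metis)
qed

text \<open>The leading terms of numerator and denominator are divided and their constants merged
  into one. Two natural exponents stand in for one integer exponent of \<open>t\<close>.\<close>

lemma fract_leading_term:
  assumes "\<phi> \<noteq> 0"
  obtains a i j where "a \<noteq> 0"
    "val_less w (of_poly [:a:] * t ^ i / t ^ j) (\<phi> - of_poly [:a:] * t ^ i / t ^ j)"
    "w \<phi> = v a + nmult i \<Delta> - nmult j \<Delta>"
proof -
  obtain f g where \<phi>: "\<phi> = Fract f g" "f \<noteq> 0" "g \<noteq> 0"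
    using assms by (cases \<phi> rule: Fract_cases_nonzero) auto
  obtain a i where a: "a \<noteq> 0"
      "val_less w (of_poly [:a:] * t ^ i) (of_poly f - of_poly [:a:] * t ^ i)"
    using poly_leading_term[OF \<phi>(2)] by blast
  obtain b j where b: "b \<noteq> 0"
      "val_less w (of_poly [:b:] * t ^ j) (of_poly g - of_poly [:b:] * t ^ j)"
    using poly_leading_term[OF \<phi>(3)] by blast
  have "of_poly [:a:] = of_poly [:b:] * of_poly [:a / b:]"
    using b(1) by (simp flip: of_poly_simps(4))
  then have eq: "of_poly [:a:] * t ^ i / (of_poly [:b:] * t ^ j) = of_poly [:a / b:] * t ^ i / t ^ j"
    using b(1) by simp
  have less: "val_less w (of_poly [:a / b:] * t ^ i / t ^ j) (\<phi> - of_poly [:a / b:] * t ^ i / t ^ j)"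
    using w.leading_term_divide[OF a(2) b(2)] \<phi> unfolding eq by (simp add: Fract_eq_of_poly)
  have "w (of_poly [:a / b:] * t ^ i / t ^ j) = v (a / b) + nmult i \<Delta> - nmult j \<Delta>"
    using a(1) b(1) by (simp add: w.divide w_term w.power flip: \<Delta>_eq)
  with w.leading_term(2)[OF less] show ?thesis
    using that[of "a / b" i j] less a(1) b(1) by simp
qed

text \<open>Leading terms show that every value is \<open>v a\<close> plus an integer multiple of
  \<open>\<Delta>\<close>, and the quotients \<open>a * t ^ i / t ^ j\<close> realize all such
  sums.\<close>

lemma value_group_direct_sum:
  "internal_direct_sum (value_group w) (group_closure {\<Delta>}) (value_group v)"
  unfolding internal_direct_sum_def
proof
  have "w \<phi> \<in> {x + y |x y. x \<in> group_closure {\<Delta>} \<and> y \<in> value_group v}" if \<phi>: "\<phi> \<noteq> 0" for \<phi>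
  proof -
    obtain a i j where "a \<noteq> 0" "w \<phi> = v a + nmult i \<Delta> - nmult j \<Delta>"
      using fract_leading_term[OF \<phi>] by metis
    then have "w \<phi> = (nmult i \<Delta> - nmult j \<Delta>) + v a" "v a \<in> value_group v"
      by (simp_all add: algebra_simps value_group_def)
    then show ?thesis unfolding group_closure_singleton by blast
  qed
  moreover have "nmult i \<Delta> - nmult j \<Delta> + v a \<in> value_group w" if "a \<noteq> 0" for i j a
  proof -
    have "w (of_poly [:a:] * t ^ i / t ^ j) = nmult i \<Delta> - nmult j \<Delta> + v a"
      using that by (simp add: w.divide w_term w.power flip: \<Delta>_eq)
    then show ?thesis
      using that unfolding value_group_def
      by (intro image_eqI[of _ w "of_poly [:a:] * t ^ i / t ^ j"]) auto
  qed
  ultimately show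
    "value_group w = {x + y |x y. x \<in> group_closure {\<Delta>} \<and> y \<in> value_group v}"
    unfolding group_closure_singleton by (fastforce simp: value_group_def[of w] value_group_def[of v])
  have "x = 0" if x: "x \<in> group_closure {\<Delta>}" "x \<in> value_group v" for x
  proof -
    obtain i j where "x = nmult i \<Delta> - nmult j \<Delta>"
      using x(1) unfolding group_closure_singleton by blast
    moreover obtain a where "x = v a" "a \<noteq> 0"
      using x(2) unfolding value_group_def by blast
    \<comment> \<open>Because \<open>v 1 = 0\<close>, the two descriptions of \<open>x\<close> say
      that \<open>v a + nmult j \<Delta> = v 1 + nmult i \<Delta>\<close>, whence
      \<open>i = j\<close>.\<close>
    ultimately show "x = 0" using nmult_eq_imp_eq[of a 1 j i] by (simp add: algebra_simps)
  qed
  then show "group_closure {\<Delta>} \<inter> value_group v = {0}"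
    using v.zero_in_value_group by auto
qed

text \<open>Value 0 forces equal exponents in the leading term, so the powers of \<open>t\<close>
  cancel and a constant remains. This is the surjectivity needed for the residue fields.\<close>

lemma unit_leading_term:
  assumes "\<phi> \<noteq> 0" "w \<phi> = 0"
  shows "\<exists>a. a \<noteq> 0 \<and> val_less w (of_poly [:a:]) (\<phi> - of_poly [:a:])"
proof -
  obtain a i j where a: "a \<noteq> 0"
      "val_less w (of_poly [:a:] * t ^ i / t ^ j) (\<phi> - of_poly [:a:] * t ^ i / t ^ j)"
      "w \<phi> = v a + nmult i \<Delta> - nmult j \<Delta>"
    using fract_leading_term[OF assms(1)] by metis
  then have "i = j" using nmult_eq_imp_eq[of a 1 i j] assms(2) by simp
  then show ?thesis using a by auto
qed

end

section \<open>Rational functions evaluated along the sequence\<close>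

lemma has_value_at_Fract:
  assumes "poly g a \<noteq> 0"
  shows "has_value_at (Fract f g) a y \<longleftrightarrow> y = poly f a / poly g a"
proof
  assume "has_value_at (Fract f g) a y"
  then obtain f' g' where *: "Fract f g = Fract f' g'" "poly g' a \<noteq> 0" "y = poly f' a / poly g' a"
    by (auto simp: has_value_at_def)
  have "g \<noteq> 0" "g' \<noteq> 0" using assms * by auto
  \<comment> \<open>Equality of fractions is a polynomial identity and survives evaluation, so the
    value is independent of the representation.\<close>
  then have "poly (f * g') a = poly (f' * g) a" using * by (simp add: eq_fract)
  then show "y = poly f a / poly g a" using assms *(2)
    unfolding *(3) by (simp add: frac_eq_eq)
qed (use assms in \<open>auto simp: has_value_at_def\<close>)

lemma V_seq_iff:
  assumes "\<forall>\<^sub>F n in sequentially. poly g (s n) \<noteq> 0"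
  shows "Fract f g \<in> V_seq V s \<longleftrightarrow> (\<forall>\<^sub>F n in sequentially. poly f (s n) / poly g (s n) \<in> V)"
proof -
  have "Fract f g \<in> V_seq V s \<longleftrightarrow>
      (\<forall>\<^sub>F n in sequentially. \<exists>y\<in>V. has_value_at (Fract f g) (s n) y)"
    by (simp add: V_seq_def eventually_cofinite flip: cofinite_eq_sequentially)
  also have "\<dots> \<longleftrightarrow> (\<forall>\<^sub>F n in sequentially. poly f (s n) / poly g (s n) \<in> V)"
    by (intro eventually_cong[OF assms]) (auto simp: has_value_at_Fract)
  finally show ?thesis .
qed

text \<open>The inequality on the left says that \<open>f / g\<close> lies in
  \<open>V_seq V s\<close>, which is a condition on the values at almost all \<open>s n\<close>.
  This translates comparisons under \<open>w\<close> into comparisons along the sequence.\<close>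

lemma V_seq_val_le_iff:
  assumes V: "valuation_domain_with V v" and W: "valuation_domain_with (V_seq V s) w"
    and f: "\<forall>\<^sub>F n in sequentially. poly f (s n) \<noteq> 0"
    and g: "\<forall>\<^sub>F n in sequentially. poly g (s n) \<noteq> 0"
  shows "w (of_poly g) \<le> w (of_poly f) \<longleftrightarrow>
    (\<forall>\<^sub>F n in sequentially. v (poly g (s n)) \<le> v (poly f (s n)))"
proof -
  interpret v: valued_field v using V by unfold_locales (simp add: valuation_domain_with_def)
  interpret w: valued_field w using W by unfold_locales (simp add: valuation_domain_with_def)
  have nz: "f \<noteq> 0" "g \<noteq> 0"
    using f g by (auto dest: eventually_happens)
  have "w (of_poly g) \<le> w (of_poly f) \<longleftrightarrow> Fract f g \<in> V_seq V s"
    using W nz by (simp add: valuation_domain_with_def Fract_eq_of_poly w.divide)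
  also have "\<dots> \<longleftrightarrow> (\<forall>\<^sub>F n in sequentially. poly f (s n) / poly g (s n) \<in> V)"
    using g by (rule V_seq_iff)
  also have "\<dots> \<longleftrightarrow> (\<forall>\<^sub>F n in sequentially. v (poly g (s n)) \<le> v (poly f (s n)))"
    using V by (intro eventually_cong[OF eventually_conj[OF f g]])
      (auto simp: valuation_domain_with_def v.divide)
  finally show ?thesis .
qed

text \<open>Each \<open>\<beta> - s n\<close> is on the smaller side of some
  \<open>val_less\<close>, hence nonzero. So infinite values never occur, and the increase is one of
  genuine values.\<close>

lemma pseudo_limit_strict_mono:
  assumes "pseudo_limit v s \<beta>"
  shows "s n \<noteq> \<beta>" and "strict_mono (\<lambda>n. v (\<beta> - s n))"
proof -
  have *: "val_less v (\<beta> - s n) (\<beta> - s (Suc n))" for n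
    using assms by (simp add: pseudo_limit_def)
  show **: "s n \<noteq> \<beta>" for n using *[of n] by (auto simp: val_less_def)
  show "strict_mono (\<lambda>n. v (\<beta> - s n))"
    unfolding strict_mono_Suc_iff
  proof
    fix n
    show "v (\<beta> - s n) < v (\<beta> - s (Suc n))" using *[of n] **[of "Suc n"] by (auto simp: val_less_def)
  qed
qed

lemma V_seq_nontorsion:
  assumes V: "valuation_domain_with V v" and W: "valuation_domain_with (V_seq V s) w"
    and ext: "extends_valuation w v" and \<beta>: "pseudo_limit v s \<beta>"
    and k: "nmult k (w (of_poly [:-\<beta>, 1:])) \<in> value_group v"
  shows "k = 0"
proof (rule ccontr)
  assume "k \<noteq> 0"
  interpret v: valued_field v using V by unfold_locales (simp add: valuation_domain_with_def)
  interpret w: valued_field w using W by unfold_locales (simp add: valuation_domain_with_def)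
  obtain a where a: "a \<noteq> 0" "nmult k (w (of_poly [:-\<beta>, 1:])) = v a"
    using k by (auto simp: value_group_def)
  let ?p = "[:-\<beta>, 1:] ^ k"
  have eq: "w (of_poly ?p) = w (of_poly [:a:])"
    using a ext by (simp add: w.power extends_valuation_def)
  have p: "poly ?p (s n) \<noteq> 0" and vp: "v (poly ?p (s n)) = nmult k (v (\<beta> - s n))" for n
    using pseudo_limit_strict_mono(1)[OF \<beta>, of n]
    by (simp_all add: poly_power v.power v.minus_commute[of "s n"])
  have p': "\<forall>\<^sub>F n in sequentially. poly ?p (s n) \<noteq> 0" "\<forall>\<^sub>F n in sequentially. poly [:a:] (s n) \<noteq> 0"
    using p a(1) by auto
  \<comment> \<open>Equality under \<open>w\<close> of the values of \<open>(X - \<beta>)^k\<close>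
    and of the constant \<open>a\<close> is read as two inequalities along the sequence.\<close>
  have "\<forall>\<^sub>F n in sequentially. nmult k (v (\<beta> - s n)) \<le> v a"
    "\<forall>\<^sub>F n in sequentially. v a \<le> nmult k (v (\<beta> - s n))"
    using V_seq_val_le_iff[OF V W p'] V_seq_val_le_iff[OF V W p'(2,1)]
    unfolding eq vp by simp_all
  then have "\<forall>\<^sub>F n in sequentially. nmult k (v (\<beta> - s n)) = v a"
    by eventually_elim (rule antisym)
  then obtain N where N: "\<And>n. n \<ge> N \<Longrightarrow> nmult k (v (\<beta> - s n)) = v a"
    by (auto simp: eventually_sequentially)
  have "v (\<beta> - s N) < v (\<beta> - s (Suc N))"
    using pseudo_limit_strict_mono(2)[OF \<beta>] by (simp add: strict_mono_Suc_iff)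
  from nmult_strict_mono[OF this, of k] show False
    using N[of N] N[of "Suc N"] \<open>k \<noteq> 0\<close> by simp
qed

lemma V_seq_val_linear:
  assumes V: "valuation_domain_with V v" and W: "valuation_domain_with (V_seq V s) w"
    and ext: "extends_valuation w v" and \<beta>: "pseudo_limit v s \<beta>"
  shows "w (of_poly [:-\<alpha>, 1:]) \<le> w (of_poly [:-\<beta>, 1:]) \<and>
    (w (of_poly [:-\<alpha>, 1:]) = w (of_poly [:-\<beta>, 1:]) \<longleftrightarrow> pseudo_limit v s \<alpha>)"
proof -
  interpret v: valued_field v using V by unfold_locales (simp add: valuation_domain_with_def)
  note le_iff = V_seq_val_le_iff[OF V W]
  define d where "d n = v (\<beta> - s n)" for n
  have d: "strict_mono d" and s\<beta>: "s n \<noteq> \<beta>" for n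
    using pseudo_limit_strict_mono[OF \<beta>] by (simp_all add: d_def[abs_def])
  have v\<beta>: "v (poly [:-\<beta>, 1:] (s n)) = d n" for n
    by (simp add: d_def v.minus_commute[of "s n"])
  have nz\<beta>: "\<forall>\<^sub>F n in sequentially. poly [:-\<beta>, 1:] (s n) \<noteq> 0"
    using s\<beta> by simp
  show ?thesis
  proof (cases "\<forall>n. val_less v (\<beta> - s n) (\<alpha> - \<beta>)")
    case True
    \<comment> \<open>Here \<open>\<beta> - s n\<close> leads in
      \<open>\<alpha> - s n = (\<beta> - s n) + (\<alpha> - \<beta>)\<close>, for every
      \<open>n\<close>.\<close>
    then have *: "\<alpha> - s n \<noteq> 0" "v (\<alpha> - s n) = d n" for n
      using v.val_less_nonzero_add[of "\<beta> - s n" "\<alpha> - \<beta>"] by (simp_all add: d_def)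
    then have "pseudo_limit v s \<alpha>"
      using d by (simp add: pseudo_limit_def val_less_def strict_mono_Suc_iff)
    moreover have v\<alpha>: "v (poly [:-\<alpha>, 1:] (s n)) = d n" for n
      using *(2)[of n] by (simp add: v.minus_commute[of "s n"])
    moreover have "\<forall>\<^sub>F n in sequentially. poly [:-\<alpha>, 1:] (s n) \<noteq> 0"
      using *(1) by (auto simp: eventually_sequentially)
    ultimately show ?thesis
      using le_iff[OF nz\<beta>, of "[:-\<alpha>, 1:]"] le_iff[OF _ nz\<beta>, of "[:-\<alpha>, 1:]"]
      by (simp only: v\<beta>) auto
  next
    case False
    then obtain N where N: "\<alpha> \<noteq> \<beta>" "v (\<alpha> - \<beta>) \<le> d N"
      using s\<beta> by (auto simp: val_less_def d_def not_less)
    \<comment> \<open>The constant \<open>c\<close> separates the two linear polynomials: the value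
      of \<open>X - \<alpha>\<close> is at most \<open>v c\<close>, that of
      \<open>X - \<beta>\<close> is strictly above it.\<close>
    define c where "c = \<alpha> - \<beta>"
    have c: "c \<noteq> 0" "v c \<le> d N" using N by (simp_all add: c_def)
    \<comment> \<open>At \<open>N\<close> itself equality is possible; strictness starts after it,
      and from there on \<open>c\<close> leads in
      \<open>\<alpha> - s n = c + (\<beta> - s n)\<close>.\<close>
    have gt: "v c < d n" if "n > N" for n
      using strict_monoD[OF d that] c(2) by simp
    have *: "\<alpha> - s n \<noteq> 0" "v (\<alpha> - s n) = v c" if "n > N" for n
      using v.val_less_nonzero_add[of c "\<beta> - s n"] gt[OF that] c(1)
      by (simp_all add: c_def val_less_def d_def)
    have "\<not> pseudo_limit v s \<alpha>"
    proof
      assume "pseudo_limit v s \<alpha>"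
      then have "val_less v (\<alpha> - s (Suc N)) (\<alpha> - s (Suc (Suc N)))"
        by (simp add: pseudo_limit_def)
      then show False using *[of "Suc N"] *[of "Suc (Suc N)"] by (simp add: val_less_def)
    qed
    moreover have nz\<alpha>: "\<forall>\<^sub>F n in sequentially. poly [:-\<alpha>, 1:] (s n) \<noteq> 0"
      using eventually_gt_at_top[of N] by eventually_elim (use *(1) in auto)
    have v\<alpha>: "\<forall>\<^sub>F n in sequentially. v (poly [:-\<alpha>, 1:] (s n)) = v c"
      using eventually_gt_at_top[of N]
      by eventually_elim (use *(2) v.minus_commute in force)
    have nzc: "\<forall>\<^sub>F n in sequentially. poly [:c:] (s n) \<noteq> 0"
      using c(1) by simp
    have "w (of_poly [:-\<alpha>, 1:]) \<le> w (of_poly [:c:])"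
      unfolding le_iff[OF nzc nz\<alpha>] using v\<alpha> by eventually_elim simp
    moreover have "\<not> w (of_poly [:-\<beta>, 1:]) \<le> w (of_poly [:c:])"
      unfolding le_iff[OF nzc nz\<beta>] v\<beta>
    proof
      assume "\<forall>\<^sub>F n in sequentially. d n \<le> v (poly [:c:] (s n))"
      then have "\<forall>\<^sub>F n in sequentially. False"
        using eventually_gt_at_top[of N] by eventually_elim (use gt in force)
      then show False by simp
    qed
    ultimately show ?thesis by auto
  qed
qed

theorem proposition3p11:
  fixes V :: "'k::field set"
    and v :: "'k \<Rightarrow> 'g::linordered_ab_group_add"
    and M :: "'k set"
    and s :: "nat \<Rightarrow> 'k"
    and \<alpha> \<beta> :: 'k
    and v\<^sub>E :: "'k poly fract \<Rightarrow> 'g"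
    and M\<^sub>E :: "'k poly fract set"
    and \<Delta>\<^sub>E :: 'g
  assumes V: "valuation_domain_with V v"
    and M: "maximalideal M (ring_on V)"
    and E: "pseudo_convergent v s"
    and \<beta>: "pseudo_limit v s \<beta>"
    and V\<^sub>E: "valuation_domain_with (V_seq V s) v\<^sub>E"
    and v\<^sub>E: "extends_valuation v\<^sub>E v"
    and M\<^sub>E: "maximalideal M\<^sub>E (ring_on (V_seq V s))"
    and \<Delta>\<^sub>E: "\<Delta>\<^sub>E = v\<^sub>E (of_poly [:-\<beta>, 1:])"
  shows "(v\<^sub>E (of_poly [:-\<alpha>, 1:]) \<le> v\<^sub>E (of_poly [:-\<beta>, 1:]) \<and>
          (v\<^sub>E (of_poly [:-\<alpha>, 1:]) = v\<^sub>E (of_poly [:-\<beta>, 1:]) \<longleftrightarrow> pseudo_limit v s \<alpha>)) \<and>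
         ((\<forall>k::nat. nmult k \<Delta>\<^sub>E \<in> value_group v \<longrightarrow> k = 0) \<and>
          (\<forall>\<phi>. \<phi> \<noteq> 0 \<longrightarrow> v\<^sub>E \<phi> = monomial_val v \<beta> \<Delta>\<^sub>E \<phi>)) \<and>
         internal_direct_sum (value_group v\<^sub>E) (group_closure {\<Delta>\<^sub>E}) (value_group v) \<and>
         ring_on (V_seq V s) Quot M\<^sub>E \<simeq> ring_on V Quot M"
proof -
  have nontorsion: "k = 0" if "nmult k \<Delta>\<^sub>E \<in> value_group v" for k
    using V_seq_nontorsion[OF V V\<^sub>E v\<^sub>E \<beta>] that \<Delta>\<^sub>E by simp
  interpret v: valuation_domain v V
    using V by unfold_locales (simp_all add: valuation_domain_with_def)
  interpret w: valuation_domain v\<^sub>E "V_seq V s"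
    using V\<^sub>E by unfold_locales (simp_all add: valuation_domain_with_def)
  interpret nontorsion_extension v\<^sub>E v \<beta> \<Delta>\<^sub>E "of_poly [:-\<beta>, 1:]"
    by unfold_locales (use v\<^sub>E \<Delta>\<^sub>E nontorsion in auto)
  have "ring_on (V_seq V s) Quot M\<^sub>E \<simeq> ring_on V Quot M"
  \<comment> \<open>The map \<open>h\<close> is the embedding of \<open>K\<close> as constant
    polynomials, and \<open>unit_leading_term\<close> provides the surjectivity.\<close>
  proof (rule residue_field_iso)
    show "valuation_domain v V" "valuation_domain v\<^sub>E (V_seq V s)" by unfold_locales
    show "of_poly [:1:] = (1 :: 'k poly fract)" by (simp flip: one_pCons)
    show "of_poly [:x + y:] = of_poly [:x:] + of_poly [:y:]"
      "of_poly [:x * y:] = of_poly [:x:] * of_poly [:y:]" for x y :: 'k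
      by (simp_all add: mult.commute flip: of_poly_simps(3,4))
  qed (use M M\<^sub>E w_const unit_leading_term in auto)
  then show ?thesis
    using V_seq_val_linear[OF V V\<^sub>E v\<^sub>E \<beta>] nontorsion monomial_val_eq value_group_direct_sum by auto
qed

end
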